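(* For every integer $n\ge 1$, let $k=\ell(n)+1$ where $\ell(n)$ is the length of $b(n)$, and let $G$ be the Dyck nest of length $2k$ obtained from $F(\rho(n))$ by repeated blowing. Then the clones $\sigma(G)=(\sigma_{k-1}(G),\ldots,\sigma_1(G))$ and $\sigma(F(n))=(\sigma_{k-1}(F(n)),\ldots,\sigma_1(F(n)))$ differ solely at the $\gamma(n)$-th entry: $\sigma_j(G)=\sigma_j(F(n))$ for all $j\in[1,k-1]\setminus\{\gamma(n)\}$, and $\sigma_{\gamma(n)}(G)\ne\sigma_{\gamma(n)}(F(n))$.
   Context: Dyck words and Dyck nests. A Dyck word of length $2k$ is a binary string with $k$ ones in which every prefix has at least as many 0s as 1s. Reading it left to right, 0 = up-step and 1 = down-step gives a lattice path from height 0. Its Dyck nest is the integer string obtained by labelling the steps with $1,2,\ldots,k$: process the horizontal unit layers $[y,y+1]$, $y=0,1,2,\dots$, in increasing order, and in each layer assign consecutive integers (continuing the count) to the up-steps from right to left and likewise to the down-steps from right to left. In a Dyck nest of length $2k$ the two entries equal to $k$ are adjacent. Clone. For a Dyck nest $H$ of length $2k$ and $j\in[1,k-1]$, let $p_j<r_j$ be the two positions of $H$ holding the value $j$, and set $\sigma_j(H)=\lfloor (r_j-p_j)/2\rfloor$. The clone of $H$ is $\sigma(H)=(\sigma_{k-1}(H),\ldots,\sigma_2(H),\sigma_1(H))$. Blowing. For a Dyck nest $H$ of length $2K$, $q(H)$ is obtained by inserting $(K+1)(K+1)$ between the two adjacent entries equal to $K$; repeated blowing of a nest of length $2K\le 2k$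 to length $2k$ means applying $q^{k-K}$. Tight restricted-growth strings (TRGS). A TRGS is a string $a_{L}\cdots a_1$ of nonnegative integers (positions counted from the right) such that either $L=1$ and $a_1\in\{0,1\}$, or $L\ge 2$, $a_L=1$ and $a_j\le a_{j+1}+1$ for $1\le j<L$. Order the TRGSs first by length and, within a length, lexicographically; let $b(0)=0,b(1)=1,b(2)=10,b(3)=11,b(4)=12,b(5)=100,\ldots$ be this enumeration. For $n\ge1$, $\gamma(n)$ is the position (from the right, rightmost $=1$) of the rightmost nonzero entry of $b(n)$. The parent $\rho(n)$ of $n\ge1$: if $\gamma(n)$ equals the length of $b(n)$ then $\rho(n)=0$; otherwise $b(\rho(n))$ is $b(n)$ with its entry at position $\gamma(n)$ decreased by $1$. Castling. For a Dyck nest $H$ and integer $\gamma\ge1$, write $H=W\,M\,Z$ with $|W|=\gamma-1$, $|Z|=\gamma$; let $x$ be the first entry of $M$ and split $M=X\,Y$ where $Y$ begins at the first entry of $M$ after its first entry that equals $x+1$; put $\mathrm{Cast}_\gamma(H)=W\,Y\,X\,Z$. The nests $F(n)$. $F(0)=11$; for $n\ge1$, with $k=\ell(n)+1$ and $G$ the blow of $F(\rho(n))$ to length $2k$, $F(n)=\mathrm{Cast}_{\gamma(n)}(G)$. *)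

theory Defs
  imports Main
begin

text \<open>
  A binary string is a \<open>bool list\<close>: \<open>False\<close> is the digit 0 (up-step), \<open>True\<close> is the digit 1
  (down-step).  Strings over the naturals are lists; indices into lists start at 0 on the left,
  whereas \<open>entry\<close> counts positions from 1 on the right.
\<close>

definition dyck_word :: "nat \<Rightarrow> bool list \<Rightarrow> bool" where
  "dyck_word k w \<longleftrightarrow>
     length w = 2 * k \<and> count_list w True = k \<and>
     (\<forall>i \<le> length w. count_list (take i w) True \<le> count_list (take i w) False)"

definition height :: "bool list \<Rightarrow> nat \<Rightarrow> nat" where
  "height w i = count_list (take i w) False - count_list (take i w) True"

text \<open>Step \<open>i\<close> leads from height \<open>height w i\<close> to \<open>height w (Suc i)\<close>; it lies in the unit layer
  \<open>[y, y + 1]\<close> for the following \<open>y\<close>.\<close>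

definition layer :: "bool list \<Rightarrow> nat \<Rightarrow> nat" where
  "layer w i = min (height w i) (height w (Suc i))"

text \<open>Up-steps and down-steps are numbered separately, layer by layer from the bottom and from
  right to left within a layer.  So the label of step \<open>i\<close> is the number of steps of the same
  kind that are processed no later than \<open>i\<close>.\<close>

definition label :: "bool list \<Rightarrow> nat \<Rightarrow> nat" where
  "label w i =
     card {j. j < length w \<and> w ! j = w ! i \<and>
              (layer w j < layer w i \<or> (layer w j = layer w i \<and> i \<le> j))}"

definition nest_of :: "bool list \<Rightarrow> nat list" where
  "nest_of w = map (label w) [0..<length w]"

definition dyck_nest :: "nat \<Rightarrow> nat list \<Rightarrow> bool" where
  "dyck_nest k H \<longleftrightarrow> (\<exists>w. dyck_word k w \<and> H = nest_of w)"

definition entry :: "nat list \<Rightarrow> nat \<Rightarrow> nat" where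
  "entry a j = a ! (length a - j)"

text \<open>In a Dyck nest of length \<open>2 * k\<close> every \<open>j \<in> {1..k}\<close> occurs at exactly two positions, the
  minimum and the maximum of \<open>positions H j\<close>.\<close>

definition positions :: "nat list \<Rightarrow> nat \<Rightarrow> nat set" where
  "positions H j = {i. i < length H \<and> H ! i = j}"

definition sigma :: "nat \<Rightarrow> nat list \<Rightarrow> nat" where
  "sigma j H = (Max (positions H j) - Min (positions H j)) div 2"

definition clone :: "nat list \<Rightarrow> nat list" where
  "clone H = map (\<lambda>j. sigma j H) (rev [1..<length H div 2])"

text \<open>With \<open>K = length H div 2\<close>, the new pair is inserted right after the first of the two
  (adjacent) entries \<open>K\<close>.\<close>

definition blow :: "nat list \<Rightarrow> nat list" where
  "blow H =
     (let K = length H div 2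
      in takeWhile (\<lambda>x. x \<noteq> K) H @ [K, K + 1, K + 1] @ tl (dropWhile (\<lambda>x. x \<noteq> K) H))"

definition blow_to :: "nat \<Rightarrow> nat list \<Rightarrow> nat list" where
  "blow_to k H = (blow ^^ (k - length H div 2)) H"

definition castle :: "nat \<Rightarrow> nat list \<Rightarrow> nat list" where
  "castle g H =
     (let W = take (g - 1) H;
          Z = drop (length H - g) H;
          M = drop (g - 1) (take (length H - g) H);
          x = hd M;
          X = takeWhile (\<lambda>y. y \<noteq> x + 1) M;
          Y = dropWhile (\<lambda>y. y \<noteq> x + 1) M
      in W @ Y @ X @ Z)"

definition trgs :: "nat list \<Rightarrow> bool" where
  "trgs a \<longleftrightarrow>
     (length a = 1 \<and> entry a 1 \<in> {0, 1}) \<or>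
     (length a \<ge> 2 \<and> entry a (length a) = 1 \<and>
      (\<forall>j. 1 \<le> j \<and> j < length a \<longrightarrow> entry a j \<le> entry a (j + 1) + 1))"

text \<open>The order is first by length, then lexicographic from the left, i.e.\ \<open>lenlex\<close>.  The
  \<open>n\<close>-th string of the enumeration (starting at 0) is the one with exactly \<open>n\<close> predecessors.\<close>

definition trgs_pred :: "nat list \<Rightarrow> nat list set" where
  "trgs_pred a = {s. trgs s \<and> (s, a) \<in> lenlex less_than}"

definition trgs_enum :: "nat \<Rightarrow> nat list" where
  "trgs_enum n = (THE a. trgs a \<and> card (trgs_pred a) = n)"

definition trgs_len :: "nat \<Rightarrow> nat" where
  "trgs_len n = length (trgs_enum n)"

definition gamma :: "nat \<Rightarrow> nat" where
  "gamma n = (LEAST j. 1 \<le> j \<and> j \<le> trgs_len n \<and> entry (trgs_enum n) j \<noteq> 0)"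

definition parent :: "nat \<Rightarrow> nat" where
  "parent n =
     (if gamma n = trgs_len n then 0
      else (THE m. trgs_enum m =
              (trgs_enum n)[trgs_len n - gamma n := entry (trgs_enum n) (gamma n) - 1]))"

text \<open>The enumeration is a bijection and \<open>parent n < n\<close>; the latter makes the recursion
  for \<open>nest\<close> below terminate.\<close>

lemma finite_trgs_pred: "finite (trgs_pred a)"
proof -
  have bound: "entry s (length s - i) \<le> length s" if "trgs s" "i < length s" for s i
  proof -
    have "entry s (length s - i) \<le> i + 1" using that(2)
    proof (induction i)
      case 0 then show ?case using that(1) by (auto simp: trgs_def)
    next
      case (Suc i)
      let ?j = "length s - Suc i"
      have "entry s ?j \<le> entry s (?j + 1) + 1"
        using that(1) Suc.prems unfolding trgs_def
        by (elim disjE conjE) (auto dest: spec[of _ "?j"])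
      moreover have "?j + 1 = length s - i" using Suc.prems by simp
      ultimately show ?case using Suc by simp
    qed
    then show ?thesis using that(2) by simp
  qed
  have "set s \<subseteq> {..length a} \<and> length s \<le> length a" if "s \<in> trgs_pred a" for s
  proof -
    have s: "trgs s" "length s \<le> length a"
      using that by (auto simp: trgs_pred_def lenlex_conv lexn_conv)
    have "x \<le> length s" if "x \<in> set s" for x
      using bound[OF s(1)] that by (auto simp: in_set_conv_nth entry_def)
    then show ?thesis using s(2) by force
  qed
  then have "trgs_pred a \<subseteq> {s. set s \<subseteq> {..length a} \<and> length s \<le> length a}" by blast
  then show ?thesis
    by (rule finite_subset) (simp add: finite_lists_length_le)
qed

lemma lenlex_less_trans:
  "(a, b) \<in> lenlex less_than \<Longrightarrow> (b, c) \<in> lenlex less_than \<Longrightarrow> (a, c) \<in> lenlex less_than"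
  for a b c :: "nat list"
  using lenlex_trans[of a b less_than c] by simp

lemma lenlex_less_irrefl: "(a, a) \<notin> lenlex less_than" for a :: "nat list"
  using lenlex_irreflexive[of less_than a] by simp

lemma lenlex_less_linear:
  "(a, b) \<in> lenlex less_than \<or> a = b \<or> (b, a) \<in> lenlex less_than" for a b :: "nat list"
  using total_lenlex[OF total_less_than, unfolded total_on_def] by blast

lemma trgs_card_less:
  assumes "trgs a" "(a, c) \<in> lenlex less_than"
  shows "card (trgs_pred a) < card (trgs_pred c)"
proof (rule psubset_card_mono[OF finite_trgs_pred])
  show "trgs_pred a \<subset> trgs_pred c"
  proof (rule psubsetI)
    show "trgs_pred a \<subseteq> trgs_pred c"
      unfolding trgs_pred_def using lenlex_less_trans[OF _ assms(2)] by blast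
    show "trgs_pred a \<noteq> trgs_pred c"
      unfolding trgs_pred_def using lenlex_less_irrefl[of a] assms by blast
  qed
qed

lemma trgs_card_inj:
  assumes "trgs a" "trgs c" "card (trgs_pred a) = card (trgs_pred c)"
  shows "a = c"
  using lenlex_less_linear[of a c] trgs_card_less[of a c] trgs_card_less[of c a] assms
  by linarith

lemma trgs_0: "trgs [0]" "trgs_pred [0] = {}"
  by (auto simp: trgs_pred_def lenlex_conv lexn_conv less_Suc_eq trgs_def entry_def lex_def
      length_Suc_conv)

lemma trgs_card_surj: "\<exists>a. trgs a \<and> card (trgs_pred a) = n"
proof (induction n)
  case 0
  show ?case using trgs_0 by (intro exI[of _ "[0]"]) simp
next
  case (Suc n)
  then obtain a where a: "trgs a" "card (trgs_pred a) = n" by blast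
  let ?S = "{s. trgs s \<and> (a, s) \<in> lenlex less_than}"
  let ?z = "1 # replicate (Suc (length a)) 0"
  have "trgs ?z"
    by (auto simp: trgs_def entry_def nth_Cons nth_append split: nat.splits)
  then have "?z \<in> ?S" by (simp add: lenlex_conv)
  then obtain c where c: "c \<in> ?S" "\<And>d. (d, c) \<in> lenlex less_than \<Longrightarrow> d \<notin> ?S"
    by (rule wfE_min[OF wf_lenlex[OF wf_less_than]]) blast
  have "trgs_pred c = insert a (trgs_pred a)"
  proof (intro equalityI subsetI)
    fix s assume "s \<in> trgs_pred c"
    then show "s \<in> insert a (trgs_pred a)"
      using c(2)[of s] lenlex_less_linear[of a s] by (auto simp: trgs_pred_def)
  next
    fix s assume "s \<in> insert a (trgs_pred a)"
    then show "s \<in> trgs_pred c"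
      using a(1) c(1) lenlex_less_trans[of s a c] by (auto simp: trgs_pred_def)
  qed
  moreover have "a \<notin> trgs_pred a" by (simp add: trgs_pred_def lenlex_less_irrefl)
  ultimately have "card (trgs_pred c) = Suc n"
    using a(2) finite_trgs_pred[of a] by simp
  then show ?case using c(1) by blast
qed

lemma trgs_enum: "trgs (trgs_enum n)" "card (trgs_pred (trgs_enum n)) = n"
proof -
  have "\<exists>!a. trgs a \<and> card (trgs_pred a) = n"
    using trgs_card_surj[of n] trgs_card_inj by blast
  from theI'[OF this]
  show "trgs (trgs_enum n)" "card (trgs_pred (trgs_enum n)) = n"
    unfolding trgs_enum_def by blast+
qed

lemma trgs_enum_card: "trgs a \<Longrightarrow> trgs_enum (card (trgs_pred a)) = a"
  using trgs_card_inj trgs_enum by blast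

lemma bij_betw_trgs_enum: "bij_betw trgs_enum UNIV (Collect trgs)"
  by (rule bij_betw_byWitness[where f' = "\<lambda>a. card (trgs_pred a)"])
     (auto simp: trgs_enum trgs_enum_card)

lemma trgs_enum_0: "trgs_enum 0 = [0]"
  using trgs_enum_card[of "[0]"] trgs_0 by simp

lemma gamma:
  assumes "1 \<le> n"
  shows "1 \<le> gamma n" "gamma n \<le> trgs_len n" "entry (trgs_enum n) (gamma n) \<noteq> 0"
    "\<And>j. 1 \<le> j \<Longrightarrow> j < gamma n \<Longrightarrow> entry (trgs_enum n) j = 0"
proof -
  let ?a = "trgs_enum n"
  let ?P = "\<lambda>j. 1 \<le> j \<and> j \<le> trgs_len n \<and> entry ?a j \<noteq> 0"
  have "?a \<noteq> [0]"
    using assms trgs_enum(2)[of n] trgs_enum(2)[of 0] trgs_enum_0 by auto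
  then have "?P (length ?a)"
    using trgs_enum(1)[of n]
    by (auto simp: trgs_def trgs_len_def entry_def length_Suc_conv)
  then have P: "?P (gamma n)" unfolding gamma_def by (rule LeastI)
  then show "1 \<le> gamma n" "gamma n \<le> trgs_len n" "entry ?a (gamma n) \<noteq> 0" by auto
  fix j assume j: "1 \<le> j" "j < gamma n"
  then have "\<not> ?P j" unfolding gamma_def using not_less_Least by blast
  then show "entry ?a j = 0" using j P by simp
qed

lemma parent:
  assumes "1 \<le> n" "gamma n \<noteq> trgs_len n"
  shows "trgs_enum (parent n) =
           (trgs_enum n)[trgs_len n - gamma n := entry (trgs_enum n) (gamma n) - 1]"
    and "parent n < n"
proof -
  let ?a = "trgs_enum n"
  let ?i = "trgs_len n - gamma n"
  let ?c = "?a[?i := entry ?a (gamma n) - 1]"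
  note g = gamma[OF assms(1)]
  have i: "0 < ?i" "?i < length ?a" using g assms(2) by (auto simp: trgs_len_def)
  have len: "length ?a \<ge> 2" using i by linarith
  have e: "entry ?c j = (if j = gamma n then entry ?a j - 1 else entry ?a j)"
    if "1 \<le> j" "j \<le> length ?a" for j
    using that g i by (auto simp: entry_def trgs_len_def nth_list_update)
  have a: "entry ?a (length ?a) = 1"
    "\<And>j. 1 \<le> j \<Longrightarrow> j < length ?a \<Longrightarrow> entry ?a j \<le> entry ?a (j + 1) + 1"
    using trgs_enum(1)[of n] len by (auto simp: trgs_def)
  have "entry ?c j \<le> entry ?c (j + 1) + 1" if j: "1 \<le> j" "j < length ?a" for j
    using e[of j] e[of "j + 1"] a(2)[OF j] g(4)[of j] j by (auto split: if_splits)
  moreover have "entry ?c (length ?a) = 1"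
    using e[of "length ?a"] a(1) len assms(2) by (auto simp: trgs_len_def)
  ultimately have c: "trgs ?c" using len by (auto simp: trgs_def)
  have lt: "(?c, ?a) \<in> lenlex less_than"
  proof -
    have "entry ?a (gamma n) = ?a ! ?i" by (simp add: entry_def trgs_len_def)
    then have "?a = take ?i ?a @ entry ?a (gamma n) # drop (Suc ?i) ?a"
      using id_take_nth_drop[OF i(2)] by (simp only:)
    moreover have "?c = take ?i ?a @ (entry ?a (gamma n) - 1) # drop (Suc ?i) ?a"
      by (rule upd_conv_take_nth_drop[OF i(2)])
    moreover have "(entry ?a (gamma n) - 1, entry ?a (gamma n)) \<in> less_than"
      using g(3) by simp
    moreover have "length ?c = length ?a" by simp
    ultimately have "(?c, ?a) \<in> lex less_than"
      unfolding lex_conv by blast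
    then show ?thesis by (simp add: lenlex_conv)
  qed
  let ?m = "card (trgs_pred ?c)"
  have m: "trgs_enum ?m = ?c" using trgs_enum_card[OF c] .
  have p: "parent n = ?m"
  proof -
    have "(THE m. trgs_enum m = ?c) = ?m"
    proof (rule the_equality)
      show "trgs_enum ?m = ?c" by (rule m)
      show "m = ?m" if "trgs_enum m = ?c" for m
        using trgs_enum(2)[of m] unfolding that by (rule sym)
    qed
    then show ?thesis using assms(2) by (simp add: parent_def)
  qed
  show "trgs_enum (parent n) = ?c" using p m by simp
  show "parent n < n" using p trgs_card_less[OF c lt] trgs_enum(2)[of n] by simp
qed

lemma parent_less: "1 \<le> n \<Longrightarrow> parent n < n"
  using parent(2)[of n] by (cases "gamma n = trgs_len n") (auto simp: parent_def)

function nest :: "nat \<Rightarrow> nat list" where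
  "nest n =
     (if n = 0 then [1, 1]
      else castle (gamma n) (blow_to (trgs_len n + 1) (nest (parent n))))"
  by pat_completeness auto
termination
  by (relation "measure id") (auto simp: parent_less)

declare nest.simps [simp del]

end

(* The pairs of equal entries of a nest are the nodes of a plane forest, numbered in breadth-first
   order from right to left within each level; an entry of the clone is the number of proper
   descendants of a node.  Blowing is only ever applied to a path, which it extends by one leaf.
   When castling at g is applied, the nodes 1, ..., g - 1 form a path and node g is the rightmost
   child of g - 1; castling detaches the subtree of the rightmost child of g and makes it the
   leftmost subtree below g - 1.  This does not affect the numbering, so only the number of
   descendants of g changes.  The condition a_g <= a_(g+1) + 1 on the strings says exactly that g
   still has a child to be moved. *)

theory Submission
  imports Defs
begin

section \<open>Labels computed from the kinds and layers of the steps\<close>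

text \<open>Pairs every step of a word that starts at height \<open>h\<close> with its layer.\<close>

fun steps :: "nat \<Rightarrow> bool list \<Rightarrow> (bool \<times> nat) list" where
  "steps h [] = []"
| "steps h (False # w) = (False, h) # steps (Suc h) w"
| "steps h (True # w) = (True, h - 1) # steps (h - 1) w"

definition below :: "(bool \<times> nat) list \<Rightarrow> bool \<times> nat \<Rightarrow> nat" where
  "below S x = length (filter (\<lambda>y. fst y = fst x \<and> snd y < snd x) S)"

text \<open>Within a layer the numbering runs from right to left, so a step counts its equals from
  its own position onwards. The offset \<open>f\<close> is a parameter so that, when a list is
  split, later segments can be absorbed into it.\<close>

fun numb :: "('a \<Rightarrow> nat) \<Rightarrow> 'a list \<Rightarrow> nat list" where
  "numb f [] = []"
| "numb f (x # S) = (f x + count_list (x # S) x) # numb f S"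

lemma length_steps [simp]: "length (steps h w) = length w"
  by (induction h w rule: steps.induct) auto

text \<open>The prefix condition keeps the path at nonnegative heights, so all truncated
  subtractions are genuine.\<close>

lemma steps_nth:
  assumes "\<And>i. i \<le> length w \<Longrightarrow> count_list (take i w) True \<le> count_list (take i w) False + h"
    and "i < length w"
  shows "steps h w ! i =
    (w ! i, min (h + count_list (take i w) False - count_list (take i w) True)
                (h + count_list (take (Suc i) w) False - count_list (take (Suc i) w) True))"
  using assms
proof (induction h w arbitrary: i rule: steps.induct)
  case (2 h w)
  have "count_list (take i w) True \<le> count_list (take i w) False + Suc h" if "i \<le> length w" for i
    using "2.prems"(1)[of "Suc i"] that by simp
  then show ?case using "2.IH"[of "i - 1"] "2.prems"(2) by (cases i) auto
next
  case (3 h w)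
  have "h > 0" using "3.prems"(1)[of 1] by simp
  moreover have "count_list (take i w) True \<le> count_list (take i w) False + (h - 1)" if "i \<le> length w" for i
    using "3.prems"(1)[of "Suc i"] that by simp
  ultimately show ?case using "3.IH"[of "i - 1"] "3.prems"(2) by (cases i) auto
qed simp

lemma length_numb [simp]: "length (numb f S) = length S"
  by (induction S) auto

lemma numb_nth: "i < length S \<Longrightarrow> numb f S ! i = f (S ! i) + count_list (drop i S) (S ! i)"
proof (induction S arbitrary: i)
  case (Cons x S)
  then show ?case by (cases i) auto
qed simp

lemma numb_append: "numb f (A @ B) = numb (\<lambda>x. f x + count_list B x) A @ numb f B"
  by (induction A) auto

lemma numb_map: "inj g \<Longrightarrow> numb f (map g S) = numb (f \<circ> g) S"
proof (induction S)
  case (Cons x S)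
  then show ?case by (simp add: count_list_map_conv inj_eq)
qed simp

lemma numb_cong: "(\<And>x. x \<in> set S \<Longrightarrow> f x = g x) \<Longrightarrow> numb f S = numb g S"
  by (induction S) auto

text \<open>The steps processed no later than step \<open>i\<close> split into those of lower
  layers, counted by \<open>below\<close>, and those of the same layer not to the left of
  \<open>i\<close>, counted in the suffix.\<close>

lemma nest_of_eq_numb:
  assumes "dyck_word k w"
  shows "nest_of w = numb (below (steps 0 w)) (steps 0 w)"
proof (rule nth_equalityI)
  fix i assume "i < length (nest_of w)"
  then have i: "i < length w" by (simp add: nest_of_def)
  let ?S = "steps 0 w"
  have S: "?S ! j = (w ! j, layer w j)" if "j < length w" for j
    using steps_nth[of w 0 j] assms that by (auto simp: dyck_word_def layer_def height_def)
  have 1: "below ?S (?S ! i) = card {j. j < length w \<and> w ! j = w ! i \<and> layer w j < layer w i}"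
    unfolding below_def length_filter_conv_card
    using i S by (auto intro!: arg_cong[where f = card])
  have "count_list (drop i ?S) (?S ! i) = card {j. j < length w - i \<and> ?S ! i = drop i ?S ! j}"
    by (simp add: count_list_eq_length_filter length_filter_conv_card)
  also have "\<dots> = card ((\<lambda>j. j + i) ` {j. j < length w - i \<and> ?S ! i = drop i ?S ! j})"
    by (simp add: card_image)
  also have "(\<lambda>j. j + i) ` {j. j < length w - i \<and> ?S ! i = drop i ?S ! j} =
      {j. j < length w \<and> w ! j = w ! i \<and> layer w j = layer w i \<and> i \<le> j}" (is "?A = ?B")
  proof (intro equalityI subsetI)
    fix j assume "j \<in> ?A" then show "j \<in> ?B" using i S by (auto simp: add.commute)
  next
    fix j assume "j \<in> ?B" then show "j \<in> ?A"
      using i S by (intro image_eqI[of _ _ "j - i"]) auto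
  qed
  finally have 2: "count_list (drop i ?S) (?S ! i) = card ?B" .
  have "label w i = card ({j. j < length w \<and> w ! j = w ! i \<and> layer w j < layer w i} \<union> ?B)"
    unfolding label_def by (intro arg_cong[where f = card]) auto
  also have "\<dots> = below ?S (?S ! i) + count_list (drop i ?S) (?S ! i)"
    unfolding 1 2 by (intro card_Un_disjoint) auto
  finally show "nest_of w ! i = numb (below ?S) ?S ! i"
    using i by (simp add: numb_nth nest_of_def)
qed (simp add: nest_of_def)

section \<open>Numbering under the exchange of two blocks\<close>

lemma below_append: "below (A @ B) x = below A x + below B x"
  by (simp add: below_def)

lemma below_Suc: "below S (c, Suc l) = below S (c, l) + count_list S (c, l)"
  by (induction S) (auto simp: below_def less_Suc_eq)

lemma below_eq_0: "(\<And>y. y \<in> set S \<Longrightarrow> snd x \<le> snd y) \<Longrightarrow> below S x = 0"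
  by (force simp: below_def filter_empty_conv)

lemma below_map_Suc: "below (map (apsnd Suc) S) (c, Suc l) = below S (c, l)"
  by (simp add: below_def comp_def filter_map)

text \<open>Raised steps in layers up to l are the original steps in layers below l. For a step of
  \<open>X\<close> this compensates the move of \<open>Y\<close> from its right, where equal layers
  count, to its left, where they do not.\<close>

lemma below_map_Suc_add_count:
  "below (map (apsnd Suc) S) x + count_list (map (apsnd Suc) S) x = below S x"
  by (induction S; cases x) (auto simp: below_def)

text \<open>In each layer, the shifted steps \<open>Y\<close> are the rightmost ones before the exchange, and one layer
  lower they are the leftmost ones after it.  Hence the order of numbering does not change.\<close>

lemma numb_exchange:
  assumes A: "\<And>y. y \<in> set A \<Longrightarrow> snd y < h"
    and X: "\<And>y. y \<in> set X \<Longrightarrow> h \<le> snd y"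
    and Y: "\<And>y. y \<in> set Y \<Longrightarrow> h \<le> snd y"
    and Z: "\<And>y. y \<in> set Z \<Longrightarrow> snd y \<le> h"
  defines "Y' \<equiv> map (apsnd Suc) Y"
  defines "S \<equiv> A @ X @ Y' @ Z" and "T \<equiv> A @ Y @ X @ Z"
  defines "f \<equiv> below S"
  shows "\<exists>a x y z. numb f S = a @ x @ y @ z \<and> numb (below T) T = a @ y @ x @ z \<and>
    length a = length A \<and> length x = length X \<and> length y = length Y \<and> length z = length Z"
proof -
  let ?g = "below T"
  \<comment> \<open>\<open>A\<close> lies strictly below layer \<open>h\<close>, so the moved blocks
    contribute nothing on either side.\<close>
  have a: "numb (\<lambda>x. f x + count_list (X @ Y' @ Z) x) A = numb (\<lambda>x. ?g x + count_list (Y @ X @ Z) x) A"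
  proof (rule numb_cong)
    fix y assume y: "y \<in> set A"
    have "y \<notin> set X" "y \<notin> set Y'" "y \<notin> set Y" using A[OF y] X Y by (fastforce simp: Y'_def)+
    moreover have "below X y = 0" "below Y y = 0" "below Y' y = 0"
      using A[OF y] X Y by (fastforce simp: Y'_def intro!: below_eq_0)+
    ultimately show "f y + count_list (X @ Y' @ Z) y = ?g y + count_list (Y @ X @ Z) y"
      by (simp add: f_def S_def T_def below_append)
  qed
  have x: "numb (\<lambda>x. f x + count_list (Y' @ Z) x) X = numb (\<lambda>x. ?g x + count_list Z x) X"
    using below_map_Suc_add_count[of Y]
    by (intro numb_cong) (simp add: f_def S_def T_def below_append Y'_def)
  \<comment> \<open>Steps of \<open>X\<close> and \<open>Z\<close> in layer l lie below a step of
    layer l + 1; once that step is lowered to layer l they stand to its right in the same layer.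
    They are numbered before it in both cases.\<close>
  have y: "numb (\<lambda>x. f x + count_list Z x) Y' = numb (\<lambda>x. ?g x + count_list (X @ Z) x) Y"
  proof -
    have inj: "inj (apsnd Suc :: bool \<times> nat \<Rightarrow> bool \<times> nat)" by (auto simp: inj_def)
    have "f (apsnd Suc y) + count_list Z (apsnd Suc y) = ?g y + count_list (X @ Z) y"
      if y: "y \<in> set Y" for y
    proof -
      obtain c l where cl: "y = (c, l)" by (cases y)
      have "count_list A (c, l) = 0" using Y[OF y] A[of y] cl by (auto simp: count_list_0_iff)
      moreover have "count_list Z (c, Suc l) = 0"
        using Y[OF y] Z[of "(c, Suc l)"] cl by (auto simp: count_list_0_iff)
      ultimately show ?thesis
        by (simp add: cl f_def S_def T_def below_append below_Suc Y'_def below_map_Suc[unfolded below_Suc])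
    qed
    then show ?thesis unfolding Y'_def numb_map[OF inj] by (intro numb_cong) simp
  qed
  have z: "numb f Z = numb ?g Z"
  proof (rule numb_cong)
    fix y assume y: "y \<in> set Z"
    have "below Y y = 0" "below Y' y = 0"
      using Z[OF y] Y by (fastforce simp: Y'_def intro!: below_eq_0)+
    then show "f y = ?g y" by (simp add: f_def S_def T_def below_append)
  qed
  show ?thesis
    unfolding S_def T_def numb_append a[unfolded S_def T_def] append_assoc
    using x y z
    by (intro exI conjI) (auto simp: S_def T_def numb_append a Y'_def)
qed

section \<open>Labelled plane forests as words\<close>

text \<open>A pair \<open>(c, j)\<close> stands for a step \<open>c\<close> labelled \<open>j\<close>; the steps labelled \<open>j\<close> enclose the subtree
  of node \<open>j\<close>.\<close>

definition node :: "nat \<Rightarrow> (bool \<times> nat) list \<Rightarrow> (bool \<times> nat) list" where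
  "node j R = (False, j) # R @ [(True, j)]"

text \<open>The contour walks of plane forests. Labels are arbitrary, except that the two steps of a
  node share theirs.\<close>

inductive bal :: "(bool \<times> nat) list \<Rightarrow> bool" where
  Nil: "bal []"
| node_append: "bal A \<Longrightarrow> bal B \<Longrightarrow> bal (node j A @ B)"

lemma bal_append: "bal A \<Longrightarrow> bal B \<Longrightarrow> bal (A @ B)"
  by (induction rule: bal.induct) (auto intro: bal.intros)

lemma bal_node: "bal A \<Longrightarrow> bal (node j A)"
  using node_append[of A "[]"] bal.Nil by simp

lemma bal_both: "bal E \<Longrightarrow> (c, j) \<in> set E \<Longrightarrow> (d, j) \<in> set E"
  by (induction arbitrary: c j rule: bal.induct) (auto simp: node_def; metis (full_types))+

lemma steps_bal_append:
  "bal E \<Longrightarrow> steps h (map fst E @ w) = steps h (map fst E) @ steps h w"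
  by (induction arbitrary: h w rule: bal.induct) (auto simp: node_def)

lemma steps_bal_ge: "bal E \<Longrightarrow> y \<in> set (steps h (map fst E)) \<Longrightarrow> h \<le> snd y"
proof (induction arbitrary: h rule: bal.induct)
  case (node_append A B j)
  have "h \<le> snd y" if "y \<in> set (steps (Suc h) (map fst A))"
    using node_append.IH(1)[OF that] by simp
  then show ?case using node_append.prems node_append.hyps node_append.IH(2)[of h]
    by (auto simp: node_def steps_bal_append)
qed simp

lemma steps_bal_Suc:
  "bal E \<Longrightarrow> steps (Suc h) (map fst E) = map (apsnd Suc) (steps h (map fst E))"
  by (induction arbitrary: h rule: bal.induct) (auto simp: node_def steps_bal_append)

lemma dyck_word_bal:
  assumes "bal E"
  shows "dyck_word (length E div 2) (map fst E)"
proof -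
  have "length E = 2 * count_list (map fst E) True \<and>
    count_list (map fst E) False = count_list (map fst E) True \<and>
    (\<forall>i. count_list (take i (map fst E)) True \<le> count_list (take i (map fst E)) False)"
    using assms
  proof (induction rule: bal.induct)
    case (node_append A B j)
    let ?w = "map fst (node j A @ B)"
    have "count_list (take i ?w) True \<le> count_list (take i ?w) False" for i
    proof (cases i)
      case (Suc m)
      show ?thesis
      \<comment> \<open>The difference is 0 exactly when the prefix stops before the closing step of
        the first node.\<close>
      proof (cases "m - length A")
        case 0
        then have "take i ?w = False # take m (map fst A)" using Suc by (simp add: node_def)
        then show ?thesis using node_append.IH(1) by (simp add: le_SucI)
      next
        case (Suc l)
        then have "take i ?w = False # map fst A @ True # take l (map fst B)"
          using \<open>i = Suc m\<close> by (simp add: node_def)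
        then show ?thesis using node_append.IH by simp
      qed
    qed simp
    then show ?case using node_append.IH by (simp add: node_def)
  qed simp
  then show ?thesis by (auto simp: dyck_word_def)
qed

section \<open>Forests enclosed in a path, with the labels of a Dyck nest\<close>

definition wrap :: "nat \<Rightarrow> (bool \<times> nat) list \<Rightarrow> (bool \<times> nat) list" where
  "wrap h M = map (Pair False) [1..<Suc h] @ M @ map (Pair True) (rev [1..<Suc h])"

lemma wrap_0 [simp]: "wrap 0 M = M"
  by (simp add: wrap_def)

lemma wrap_Suc: "wrap (Suc h) M = wrap h (node (Suc h) M)"
  by (simp add: wrap_def node_def)

lemma bal_wrap: "bal M \<Longrightarrow> bal (wrap h M)"
  by (induction h arbitrary: M) (auto simp: wrap_Suc bal_node)

lemma length_wrap [simp]: "length (wrap h M) = 2 * h + length M"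
  by (simp add: wrap_def)

lemma map_fst_wrap: "map fst (wrap h M) = replicate h False @ map fst M @ replicate h True"
  by (simp add: wrap_def comp_def map_replicate_const rev_map[symmetric] del: upt_Suc)

lemma steps_replicate_False:
  "steps h (replicate n False @ w) = map (Pair False) [h..<h + n] @ steps (h + n) w"
  by (induction n arbitrary: h) (auto simp: upt_rec)

lemma steps_replicate_True: "steps n (replicate n True) = map (Pair True) (rev [0..<n])"
  by (induction n) auto

text \<open>Distinctness is carried along because it leaves each label only its own up-step and
  down-step.\<close>

definition nested :: "(bool \<times> nat) list \<Rightarrow> bool" where
  "nested E \<longleftrightarrow> bal E \<and> distinct E \<and> map snd E = nest_of (map fst E)"

text \<open>Siblings are kept as a list of subtrees, so that they can be counted and the rightmost
  one split off.\<close>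

definition nodes :: "(bool \<times> nat) list list \<Rightarrow> bool" where
  "nodes cs \<longleftrightarrow> (\<forall>c \<in> set cs. \<exists>j R. bal R \<and> c = node j R)"

lemma nodes_simps [simp]:
  "nodes []" "nodes (node j R # cs) \<longleftrightarrow> bal R \<and> nodes cs" "nodes (as @ bs) \<longleftrightarrow> nodes as \<and> nodes bs"
  by (auto simp: nodes_def node_def)

lemma nodes_ConsE:
  assumes "nodes (c # cs)"
  obtains j R where "c = node j R" "bal R" "nodes cs"
  using assms by (auto simp: nodes_def)

lemma bal_concat: "nodes cs \<Longrightarrow> bal (concat cs)"
  by (induction cs) (auto intro: bal.intros elim!: nodes_ConsE)

lemma nested_dyck_nest: "nested E \<Longrightarrow> dyck_nest (length E div 2) (map snd E)"
  unfolding nested_def dyck_nest_def using dyck_word_bal by blast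

section \<open>Castling moves a subtree\<close>

lemma castle_eq:
  assumes "length W = h" "length Z = Suc h" "X = x # X'" "Y = Suc x # Y'" "Suc x \<notin> set X"
  shows "castle (Suc h) (W @ X @ Y @ Z) = W @ Y @ X @ Z"
proof -
  have "drop h (take (length (W @ X @ Y @ Z) - Suc h) (W @ X @ Y @ Z)) = X @ Y"
    using assms(1,2) by simp
  moreover have "takeWhile (\<lambda>y. y \<noteq> Suc x) (X @ Y) = X" "dropWhile (\<lambda>y. y \<noteq> Suc x) (X @ Y) = Y"
    using assms(4,5) by (auto simp: takeWhile_append dropWhile_append)
  moreover have "hd (X @ Y) = x" using assms(3) by simp
  ultimately show ?thesis using assms(1,2) by (simp add: castle_def Let_def)
qed

text \<open>The last child \<open>c\<close> of node h + 1 becomes the first child one level higher.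
  By \<open>numb_exchange\<close> every block keeps its labels, and it remains to see that castling
  cuts exactly in front of \<open>c\<close>.\<close>

lemma castle_nested:
  assumes ps: "nodes ps" and qs: "nodes (qs @ [c])"
    and E: "nested (wrap h (concat ps @ node (Suc h) (concat (qs @ [c]))))"
  shows "nested (wrap h (concat (c # ps) @ node (Suc h) (concat qs)))"
    and "castle (Suc h) (map snd (wrap h (concat ps @ node (Suc h) (concat (qs @ [c]))))) =
      map snd (wrap h (concat (c # ps) @ node (Suc h) (concat qs)))"
proof -
  let ?E = "wrap h (concat ps @ node (Suc h) (concat (qs @ [c])))"
  let ?F = "wrap h (concat (c # ps) @ node (Suc h) (concat qs))"
  obtain v R where c: "c = node v R" and R: "bal R"
    using qs by (auto simp: nodes_def)
  define P Q where "P = concat ps" and "Q = concat qs"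
  have bal: "bal P" "bal Q" "bal c"
    using ps qs R bal_concat by (auto simp: P_def Q_def c bal_node)
  define A where "A = map (Pair False) [0..<h]"
  define X where "X = steps h (map fst P) @ (False, h) # steps (Suc h) (map fst Q)"
  define Y where "Y = steps h (map fst c)"
  define Z where "Z = map (Pair True) (rev [0..<Suc h])"
  let ?Y = "map (apsnd Suc) Y"
  let ?S = "A @ X @ ?Y @ Z" and ?T = "A @ Y @ X @ Z"
  have E_eq: "?E = map (Pair False) [1..<Suc h] @ (P @ (False, Suc h) # Q) @ c @
      ((True, Suc h) # map (Pair True) (rev [1..<Suc h]))"
    and F_eq: "?F = map (Pair False) [1..<Suc h] @ c @ (P @ (False, Suc h) # Q) @
      ((True, Suc h) # map (Pair True) (rev [1..<Suc h]))"
    by (simp_all add: wrap_def node_def P_def Q_def del: upt_Suc)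
  have ZZ: "steps (Suc h) (True # replicate h True) = Z"
    using steps_replicate_True[of "Suc h"] by (simp add: Z_def)
  have S: "steps 0 (map fst ?E) = ?S"
    using bal ZZ unfolding map_fst_wrap steps_replicate_False
    by (simp add: node_def flip: P_def Q_def)
       (simp add: steps_bal_append A_def X_def Y_def steps_bal_Suc)
  have T: "steps 0 (map fst ?F) = ?T"
    using bal ZZ unfolding map_fst_wrap steps_replicate_False
    by (simp add: node_def flip: P_def Q_def)
       (simp add: steps_bal_append A_def X_def Y_def steps_bal_Suc)
  have layers: "\<And>y. y \<in> set A \<Longrightarrow> snd y < h" "\<And>y. y \<in> set X \<Longrightarrow> h \<le> snd y"
    "\<And>y. y \<in> set Y \<Longrightarrow> h \<le> snd y" "\<And>y. y \<in> set Z \<Longrightarrow> snd y \<le> h"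
    using steps_bal_ge[OF bal(1), of _ h] steps_bal_ge[OF bal(2), of _ "Suc h"]
      steps_bal_ge[OF bal(3), of _ h]
    by (fastforce simp: A_def X_def Y_def Z_def)+
  from numb_exchange[of A h X Y Z, OF layers] obtain a x y z where
    nS: "numb (below ?S) ?S = a @ x @ y @ z" and nT: "numb (below ?T) ?T = a @ y @ x @ z"
    and len: "length a = length A" "length x = length X" "length y = length Y" "length z = length Z"
    by blast
  have balE: "bal ?E" and balF: "bal ?F"
    using bal by (auto simp: bal_wrap bal_append bal_node simp flip: P_def Q_def)
  have Ea: "map snd ?E = a @ x @ y @ z"
    using E nest_of_eq_numb[OF dyck_word_bal[OF balE]] nS S by (simp add: nested_def)
  have "map snd ?E = [1..<Suc h] @ map snd (P @ (False, Suc h) # Q) @ map snd c @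
      (Suc h # rev [1..<Suc h])"
    unfolding E_eq by (simp add: comp_def del: upt_Suc)
  \<comment> \<open>Two factorizations of one list into blocks of equal lengths must agree block by
    block.\<close>
  then have "a @ x @ y @ z = [1..<Suc h] @ map snd (P @ (False, Suc h) # Q) @ map snd c @
      (Suc h # rev [1..<Suc h])" unfolding Ea .
  moreover have "length a = length [1..<Suc h]" "length x = length (map snd (P @ (False, Suc h) # Q))"
    "length y = length (map snd c)"
    using len by (simp_all add: A_def X_def Y_def)
  ultimately have parts: "a = [1..<Suc h]" "x = map snd (P @ (False, Suc h) # Q)" "y = map snd c"
      "z = Suc h # rev [1..<Suc h]"
    by (metis append_eq_append_conv)+
  have Fa: "map snd ?F = a @ y @ x @ z"
    unfolding F_eq parts by (simp add: comp_def del: upt_Suc)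
  have nF: "map snd ?F = nest_of (map fst ?F)"
    using nest_of_eq_numb[OF dyck_word_bal[OF balF]] nT T Fa by simp
  have swap: "distinct (as @ cs @ bs @ ds)" "set cs \<inter> set bs = {}"
    if "distinct (as @ bs @ cs @ ds)" for as bs cs ds :: "(bool \<times> nat) list"
    using that by auto
  have "distinct ?E" using E by (simp add: nested_def)
  note swap = swap[OF this[unfolded E_eq]]
  then have dist: "distinct ?F" and cX: "set c \<inter> set (P @ (False, Suc h) # Q) = {}"
    unfolding F_eq .
  show "nested ?F" using balF nF dist by (simp add: nested_def)
  obtain X' where X': "X = (False, h) # X'"
  proof (cases ps)
    case Nil
    then show ?thesis using that by (simp add: X_def P_def)
  next
    case (Cons p ps')
    then show ?thesis using that ps by (auto simp: X_def P_def nodes_def node_def)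
  qed
  have Y': "?Y = (False, Suc h) # steps (Suc (Suc h)) (map fst R) @ [(True, Suc h)]"
    using bal(3) R by (simp add: Y_def node_def steps_bal_append c flip: steps_bal_Suc)
  \<comment> \<open>The first step of \<open>X\<close> is the leftmost up-step of layer
    \<open>h\<close>, hence numbered last there; the first step of \<open>c\<close> is the rightmost
    up-step of layer h + 1, hence numbered first there. So their labels are consecutive.\<close>
  have "numb (below ?S) ?S ! length A = x ! 0"
    unfolding nS using len X' by (simp add: nth_append)
  then have x0: "x ! 0 = below ?S (False, h) + count_list (X @ ?Y @ Z) (False, h)"
    using X' by (simp add: numb_nth)
  have "numb (below ?S) ?S ! (length A + length X) = y ! 0"
    unfolding nS using len Y' by (auto simp: nth_append)
  moreover have "length A + length X < length ?S" "?S ! (length A + length X) = (False, Suc h)"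
    using Y' by (auto simp: nth_append)
  ultimately have y0: "y ! 0 = below ?S (False, Suc h) + count_list (?Y @ Z) (False, Suc h)"
    by (simp add: numb_nth)
  have "count_list (?Y @ Z) (False, Suc h) = 1"
    using steps_bal_ge[OF R, of "(False, Suc h)" "Suc (Suc h)"] Y'
    by (auto simp: count_list_0_iff Z_def)
  moreover have "count_list A (False, h) = 0" by (auto simp: count_list_0_iff A_def)
  ultimately have y0x0: "y ! 0 = Suc (x ! 0)" using x0 y0 by (simp add: below_Suc)
  have xx: "x = x ! 0 # tl x" using len X' by (cases x) auto
  have yy: "y = Suc (x ! 0) # tl y" using len Y' y0x0 by (cases y) auto
  have v: "Suc (x ! 0) = v" using y0x0 unfolding parts c by (simp add: node_def)
  \<comment> \<open>An earlier occurrence of \<open>v\<close> would bring a second copy of the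
    up-step of \<open>c\<close>, against distinctness.\<close>
  have "v \<notin> set x"
  proof
    assume "v \<in> set x"
    then have "(False, v) \<in> set (P @ (False, Suc h) # Q)"
      using bal_both[OF bal(1)] bal_both[OF bal(2)] by (auto simp: parts)
    then show False using cX by (auto simp: c node_def)
  qed
  then have "castle (Suc h) (a @ x @ y @ z) = a @ y @ x @ z"
    using v by (intro castle_eq[OF _ _ xx yy]) (simp_all add: parts(1,4))
  then show "castle (Suc h) (map snd ?E) = map snd ?F"
    using Ea Fa by simp
qed

section \<open>Clone entries as numbers of descendants\<close>

lemma sigma_append:
  assumes "j \<in> set S" "j \<notin> set A" "j \<notin> set B"
  shows "sigma j (A @ S @ B) = sigma j S"
proof -
  have eq: "positions (A @ S @ B) j = (\<lambda>i. length A + i) ` positions S j"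
  proof (intro equalityI subsetI)
    fix i assume i: "i \<in> positions (A @ S @ B) j"
    then have "length A \<le> i" "i < length A + length S"
      using assms(2,3) nth_mem[of i A] nth_mem[of "i - length A - length S" B]
      by (auto simp: positions_def nth_append not_less[symmetric] split: if_splits)
    then show "i \<in> (\<lambda>i. length A + i) ` positions S j"
      using i by (intro image_eqI[of _ _ "i - length A"]) (auto simp: positions_def nth_append)
  qed (auto simp: positions_def nth_append)
  have fin: "finite (positions S j)" "positions S j \<noteq> {}"
    using assms(1) by (auto simp: positions_def in_set_conv_nth)
  have "mono (\<lambda>i. length A + i)" by (simp add: mono_def)
  then show ?thesis
    unfolding sigma_def eq
    by (simp add: mono_Max_commute[symmetric] mono_Min_commute[symmetric] fin)
qed

lemma sigma_segment:
  assumes "distinct (A @ S @ B)" "bal S" "(d, j) \<in> set S"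
  shows "sigma j (map snd (A @ S @ B)) = sigma j (map snd S)"
proof -
  have "(e, j) \<in> set S" for e using bal_both[OF assms(2,3)] .
  then show ?thesis using assms(1) unfolding map_append
    by (intro sigma_append) (force)+
qed

text \<open>When \<open>R\<close> labels a balanced word its length is even, and the value is the
  number of proper descendants.\<close>

lemma sigma_node:
  assumes "j \<notin> set R"
  shows "sigma j (j # R @ [j]) = Suc (length R) div 2"
proof -
  have "i = 0 \<or> i = Suc (length R)" if "(j # R @ [j]) ! i = j" "i < length R + 2" for i
    using that assms nth_mem[of "i - 1" R] by (auto simp: nth_Cons nth_append split: nat.splits if_splits)
  then have "positions (j # R @ [j]) j = {0, Suc (length R)}"
    by (auto simp: positions_def)
  then show ?thesis by (simp add: sigma_def)
qed

text \<open>Meant for the nodes of the enclosing path, whose positions do not notice a rearrangement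
  of the middle.\<close>

lemma sigma_outer:
  assumes "length M = length M'" "j \<notin> set M" "j \<notin> set M'"
  shows "sigma j (A @ M @ B) = sigma j (A @ M' @ B)"
proof -
  have ne: "M ! i \<noteq> j" "M' ! i \<noteq> j" if "i < length M'" for i
    using that assms nth_mem by metis+
  have "positions (A @ M @ B) j = positions (A @ M' @ B) j"
    using ne by (auto simp: positions_def nth_append assms(1))
  then show ?thesis by (simp add: sigma_def)
qed

lemma sigma_wrap_node:
  assumes "nested (wrap h (P @ node j Q))" "bal Q"
  shows "sigma j (map snd (wrap h (P @ node j Q))) = Suc (length Q) div 2"
proof -
  let ?A = "map (Pair False) [1..<Suc h] @ P" and ?B = "map (Pair True) (rev [1..<Suc h])"
  have eq: "wrap h (P @ node j Q) = ?A @ node j Q @ ?B" by (simp add: wrap_def)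
  have d: "distinct (?A @ node j Q @ ?B)" using assms(1) unfolding eq by (simp add: nested_def)
  have "(False, j) \<in> set (node j Q)" by (simp add: node_def)
  from sigma_segment[OF d bal_node[OF assms(2)] this]
  have "sigma j (map snd (wrap h (P @ node j Q))) = sigma j (map snd (node j Q))"
    unfolding eq .
  moreover have "j \<notin> set (map snd Q)"
    using d bal_both[OF assms(2)] by (auto simp: node_def)
  ultimately show ?thesis using sigma_node[of j "map snd Q"] by (simp add: node_def)
qed

text \<open>\<open>P\<close>, \<open>Q\<close> and \<open>c\<close> move as whole blocks, and the
  path stays in place; only node h + 1 has a step on each side of a moved block boundary that
  shifts.\<close>

lemma sigma_castle:
  assumes E: "nested (wrap h (P @ node (Suc h) (Q @ c)))"
    and F: "nested (wrap h (c @ P @ node (Suc h) Q))"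
    and bal: "bal P" "bal Q" "bal c"
    and j: "j \<noteq> Suc h"
  shows "sigma j (map snd (wrap h (P @ node (Suc h) (Q @ c)))) =
    sigma j (map snd (wrap h (c @ P @ node (Suc h) Q)))"
proof -
  let ?E = "wrap h (P @ node (Suc h) (Q @ c))" and ?F = "wrap h (c @ P @ node (Suc h) Q)"
  let ?U = "map (Pair False) [1..<Suc h]" and ?D = "map (Pair True) (rev [1..<Suc h])"
  have d: "distinct ?E" "distinct ?F" using E F by (auto simp: nested_def)
  have seg: "sigma j (map snd ?E) = sigma j (map snd ?F)"
    if "?E = A @ S @ B" "?F = A' @ S @ B'" "bal S" "j \<in> snd ` set S" for A B A' B' S
    using that sigma_segment[of A S B] sigma_segment[of A' S B'] d by auto
  consider "j \<in> snd ` set P" | "j \<in> snd ` set Q" | "j \<in> snd ` set c" | "j \<notin> snd ` set (P @ Q @ c)"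
    by auto
  then show ?thesis
  proof cases
    case 1
    show ?thesis
      by (rule seg[OF _ _ bal(1) 1, of ?U "node (Suc h) (Q @ c) @ ?D" "?U @ c" "node (Suc h) Q @ ?D"])
         (auto simp: wrap_def)
  next
    case 2
    show ?thesis
      by (rule seg[OF _ _ bal(2) 2, of "?U @ P @ [(False, Suc h)]" "c @ (True, Suc h) # ?D"
            "?U @ c @ P @ [(False, Suc h)]" "(True, Suc h) # ?D"])
         (auto simp: wrap_def node_def)
  next
    case 3
    show ?thesis
      by (rule seg[OF _ _ bal(3) 3, of "?U @ P @ (False, Suc h) # Q" "(True, Suc h) # ?D"
            ?U "P @ node (Suc h) Q @ ?D"])
         (auto simp: wrap_def node_def)
  next
    case 4
    then have "j \<notin> set (map snd (P @ node (Suc h) (Q @ c)))"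
      "j \<notin> set (map snd (c @ P @ node (Suc h) Q))" using j by (auto simp: node_def)
    then show ?thesis unfolding wrap_def map_append
      by (intro sigma_outer) (auto simp: node_def)
  qed
qed

section \<open>Paths and their blowing\<close>

definition chain :: "nat \<Rightarrow> nat list" where
  "chain n = [1..<Suc n] @ rev [1..<Suc n]"

lemma blow_chain: "blow (chain (Suc n)) = chain (Suc (Suc n))"
proof -
  have "takeWhile (\<lambda>x. x \<noteq> Suc n) (chain (Suc n)) = [1..<Suc n]"
    "dropWhile (\<lambda>x. x \<noteq> Suc n) (chain (Suc n)) = Suc n # rev [1..<Suc (Suc n)]"
    by (auto simp: chain_def takeWhile_append dropWhile_append)
  moreover have "length (chain (Suc n)) div 2 = Suc n" by (simp add: chain_def)
  ultimately show ?thesis unfolding blow_def Let_def by (simp add: chain_def)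
qed

lemma blow_to_chain: "blow_to (Suc n) [1, 1] = chain (Suc n)"
proof -
  have "(blow ^^ n) (chain 1) = chain (Suc n)"
    by (induction n) (auto simp: blow_chain)
  then show ?thesis by (simp add: blow_to_def chain_def)
qed

lemma numb_distinct: "distinct S \<Longrightarrow> numb f S = map (\<lambda>x. Suc (f x)) S"
  by (induction S) auto

lemma count_list_distinct: "distinct S \<Longrightarrow> x \<in> set S \<Longrightarrow> count_list S x = 1"
  by (induction S) (auto simp: count_list_0_iff)

lemma chain_nested: "nested (wrap n [])" "map snd (wrap n []) = chain n"
proof -
  let ?S = "map (Pair False) [0..<n] @ map (Pair True) (rev [0..<n])"
  have S: "steps 0 (map fst (wrap n [])) = ?S"
    unfolding map_fst_wrap using steps_replicate_True[of n] by (simp add: steps_replicate_False)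
  have dS: "distinct ?S" and dw: "distinct (wrap n [])" by (auto simp: distinct_map inj_on_def wrap_def)
  \<comment> \<open>A path has one step of each kind in every layer, so l of them lie below layer
    l.\<close>
  have "count_list ?S (c, l) = 1" if "l < n" for c l
    using that by (intro count_list_distinct[OF dS]) (cases c; auto)
  then have "below ?S (c, l) = l" if "l \<le> n" for c l
    using that by (induction l) (auto simp: below_Suc below_eq_0)
  then have "numb (below ?S) ?S = map (\<lambda>x. Suc (snd x)) ?S"
    unfolding numb_distinct[OF dS] by (intro map_cong) auto
  also have "\<dots> = chain n"
    by (simp add: chain_def comp_def map_Suc_upt flip: rev_map del: upt_Suc)
  finally show "map snd (wrap n []) = chain n" "nested (wrap n [])"
    using dw S bal_wrap[OF bal.Nil] nest_of_eq_numb[OF dyck_word_bal, of "wrap n []"]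
    by (auto simp: nested_def wrap_def chain_def comp_def simp del: upt_Suc)
qed

section \<open>Castling in terms of numbers of children\<close>

text \<open>With a root \<open>0\<close> added, the nodes \<open>0, \<dots>, h\<close> form a path, node \<open>h\<close> has \<open>p + 1\<close> children, the
  rightmost of which is node \<open>h + 1\<close>, and node \<open>h + 1\<close> has \<open>q\<close> children.\<close>

definition shape :: "nat \<Rightarrow> nat \<Rightarrow> nat \<Rightarrow> nat list \<Rightarrow> bool" where
  "shape h p q H \<longleftrightarrow> (\<exists>ps qs. length ps = p \<and> length qs = q \<and> nodes ps \<and> nodes qs \<and>
     nested (wrap h (concat ps @ node (Suc h) (concat qs))) \<and>
     H = map snd (wrap h (concat ps @ node (Suc h) (concat qs))))"

lemma shape_chain: "shape h 0 1 (chain (Suc (Suc h)))"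
proof -
  have "wrap (Suc (Suc h)) [] = wrap h (concat [] @ node (Suc h) (concat [node (Suc (Suc h)) []]))"
    by (simp add: wrap_Suc)
  moreover have "nodes [node (Suc (Suc h)) []]" by (simp add: bal.Nil)
  ultimately show ?thesis
    using chain_nested[of "Suc (Suc h)"] unfolding shape_def
    by (intro exI[of _ "[]"] exI[of _ "[node (Suc (Suc h)) []]"]) simp
qed

text \<open>The last path node h + 1 is read as the node to be castled at: it is an only child, and
  its children are \<open>ps\<close> together with node h + 2.\<close>

lemma shape_pred:
  assumes "shape (Suc h) p q H"
  shows "shape h 0 (Suc p) H"
proof -
  obtain ps qs where 1: "length ps = p" "nodes ps" "nodes qs"
    "nested (wrap (Suc h) (concat ps @ node (Suc (Suc h)) (concat qs)))"
    "H = map snd (wrap (Suc h) (concat ps @ node (Suc (Suc h)) (concat qs)))"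
    using assms by (auto simp: shape_def)
  let ?qs = "ps @ [node (Suc (Suc h)) (concat qs)]"
  have "nodes ?qs" using 1 by (simp add: bal_concat)
  then show ?thesis
    using 1 unfolding shape_def by (intro exI[of _ "[]"] exI[of _ ?qs]) (simp add: wrap_Suc)
qed

text \<open>A path node above node \<open>h\<close> has only the next path node as a child, while
  node \<open>h\<close> itself has p + 1 children.\<close>

lemma shape_lower:
  assumes "shape h p q H" "i < h"
  shows "shape i 0 (if Suc i = h then Suc p else 1) H"
  using assms
proof (induction h arbitrary: p q)
  case (Suc h)
  from shape_pred[OF Suc.prems(1)] Suc.IH[of 0 "Suc p"] Suc.prems(2) show ?case
    by (cases "i = h") (auto split: if_splits)
qed simp

lemma shape_dyck_nest: "shape h p q H \<Longrightarrow> dyck_nest (length H div 2) H"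
  using nested_dyck_nest by (fastforce simp: shape_def)

text \<open>Node h + 1 loses a child and node \<open>h\<close> gains one. The moved subtree is
  nonempty, hence the strict decrease.\<close>

lemma shape_castle:
  assumes "shape h p (Suc q) H"
  shows "shape h (Suc p) q (castle (Suc h) H)"
    and "length (castle (Suc h) H) = length H"
    and "\<And>j. j \<noteq> Suc h \<Longrightarrow> sigma j (castle (Suc h) H) = sigma j H"
    and "sigma (Suc h) (castle (Suc h) H) < sigma (Suc h) H"
proof -
  obtain ps qs' where 1: "length ps = p" "length qs' = Suc q" "nodes ps" "nodes qs'"
    "nested (wrap h (concat ps @ node (Suc h) (concat qs')))"
    "H = map snd (wrap h (concat ps @ node (Suc h) (concat qs')))"
    using assms by (auto simp: shape_def)
  then obtain qs c where qs': "qs' = qs @ [c]" by (cases qs' rule: rev_cases) auto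
  then obtain v R where c: "c = node v R" "bal R" "nodes qs" "nodes (qs @ [c])"
    using 1(4) by (auto simp: nodes_def)
  let ?F = "wrap h (concat (c # ps) @ node (Suc h) (concat qs))"
  have F: "nested ?F" "castle (Suc h) H = map snd ?F"
    using castle_nested[OF 1(3) c(4)] 1 qs' by auto
  have "nodes (c # ps)" using c 1 by simp
  then show "shape h (Suc p) q (castle (Suc h) H)"
    unfolding shape_def using F c 1 qs' by (intro exI[of _ "c # ps"] exI[of _ qs]) auto
  show "length (castle (Suc h) H) = length H"
    unfolding F(2) unfolding 1(6) qs' by (simp add: node_def)
  show "sigma j (castle (Suc h) H) = sigma j H" if "j \<noteq> Suc h" for j
    using sigma_castle[of h "concat ps" "concat qs" c j] that F 1 qs' c
    by (simp add: bal_concat bal_node)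
  have "sigma (Suc h) H = Suc (length (concat qs')) div 2"
    unfolding 1(6) using 1(4,5) by (intro sigma_wrap_node) (auto simp: bal_concat)
  moreover have "sigma (Suc h) (castle (Suc h) H) = Suc (length (concat qs)) div 2"
    unfolding F(2) using F(1) c(3) by (intro sigma_wrap_node) (auto simp: bal_concat)
  ultimately show "sigma (Suc h) (castle (Suc h) H) < sigma (Suc h) H"
    using qs' c by (simp add: node_def)
qed

section \<open>Induction along the parents\<close>

lemma trgs_len_parent: "n \<ge> 1 \<Longrightarrow> gamma n \<noteq> trgs_len n \<Longrightarrow> trgs_len (parent n) = trgs_len n"
  using parent by (simp add: trgs_len_def)

lemma entry_parent:
  assumes "n \<ge> 1" "gamma n \<noteq> trgs_len n" "1 \<le> j" "j \<le> trgs_len n"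
  shows "entry (trgs_enum (parent n)) j =
    (if j = gamma n then entry (trgs_enum n) j - 1 else entry (trgs_enum n) j)"
  using assms gamma[OF assms(1)] parent(1)[OF assms(1,2)]
  by (auto simp: entry_def trgs_len_def nth_list_update)

text \<open>Here \<open>q\<close> is the amount by which the entry at \<open>gamma n\<close> may still grow.\<close>

lemma shape_nest:
  assumes "n \<ge> 1"
  defines "L \<equiv> trgs_len n" and "g \<equiv> gamma n" and "e \<equiv> entry (trgs_enum n)"
  defines "q \<equiv> (if g = L then 0 else e (g + 1) + 1 - e g)"
  shows "length (blow_to (L + 1) (nest (parent n))) = 2 * (L + 1) \<and>
    shape (g - 1) (e g - 1) (Suc q) (blow_to (L + 1) (nest (parent n)))"
  using assms(1) unfolding L_def g_def e_def q_def
proof (induction n rule: less_induct)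
  case (less n)
  let ?L = "trgs_len n" and ?g = "gamma n" and ?e = "entry (trgs_enum n)"
  note g = gamma[OF less.prems]
  have t: "trgs (trgs_enum n)" by (rule trgs_enum)
  show ?case
  proof (cases "?g = ?L")
    case True
    \<comment> \<open>The parent is 0, and \<open>[1, 1]\<close> blows up to the path with L + 1
      nodes, where node L has a single child.\<close>
    then have G: "blow_to (?L + 1) (nest (parent n)) = chain (Suc ?L)"
      using blow_to_chain[of ?L] by (simp add: parent_def nest.simps[of 0])
    have "?e ?g = 1" using t g True by (auto simp: trgs_def trgs_len_def)
    moreover have "Suc (Suc (?g - 1)) = Suc ?L" using g True by simp
    ultimately show ?thesis using shape_chain[of "?g - 1"] True unfolding G
      by (simp add: chain_def)
  next
    case False
    define m where "m = parent n"
    let ?e' = "entry (trgs_enum m)"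
    have Lm: "trgs_len m = ?L" using trgs_len_parent less.prems False by (simp add: m_def)
    have e': "?e' j = (if j = ?g then ?e j - 1 else ?e j)" if "1 \<le> j" "j \<le> ?L" for j
      using entry_parent[OF less.prems False that] by (simp add: m_def)
    have gL: "?g < ?L" using g False by simp
    have "?e ?L = 1" and tight: "?e ?g \<le> ?e (?g + 1) + 1"
      using t g gL by (auto simp: trgs_def trgs_len_def)
    then have "?e' ?L = 1" using e'[of ?L] gL by simp
    \<comment> \<open>The string of \<open>m\<close> starts with 1, unlike that of 0.\<close>
    have m1: "m \<ge> 1"
    proof (rule ccontr)
      assume "\<not> m \<ge> 1"
      then have "trgs_enum m = [0]" using trgs_enum_0 by (cases m) auto
      then show False using Lm \<open>?e' ?L = 1\<close> by (simp add: trgs_len_def entry_def)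
    qed
    note gm = gamma[OF m1]
    \<comment> \<open>The zeros to the right of position \<open>gamma n\<close> are inherited by the
      parent.\<close>
    have ge: "?g \<le> gamma m"
      using gm(1,2,3) e'[of "gamma m"] g(4)[of "gamma m"] Lm by (cases "gamma m < ?g") auto
    define h p q where "h = gamma m - 1" and "p = ?e' (gamma m) - 1"
      and "q = (if gamma m = trgs_len m then 0 else ?e' (gamma m + 1) + 1 - ?e' (gamma m))"
    have IH: "length (blow_to (?L + 1) (nest (parent m))) = 2 * (?L + 1)"
      "shape h p (Suc q) (blow_to (?L + 1) (nest (parent m)))"
      using less.IH[of m] parent_less[OF less.prems] m1 Lm unfolding m_def[symmetric] h_def p_def q_def
      by auto
    have nm: "nest m = castle (Suc h) (blow_to (?L + 1) (nest (parent m)))"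
      using m1 gm(1) Lm by (simp add: nest.simps[of m] h_def)
    have len: "length (nest m) = 2 * (?L + 1)" and sh: "shape h (?e' (gamma m)) q (nest m)"
      using shape_castle(1,2)[OF IH(2)] IH(1) gm(3) unfolding nm by (auto simp: p_def)
    \<comment> \<open>The parent string has the same length, so its nest already has full length and
      no blowing occurs.\<close>
    have G: "blow_to (?L + 1) (nest m) = nest m" using len by (simp add: blow_to_def)
    have "shape (?g - 1) (?e ?g - 1) (Suc (?e (?g + 1) + 1 - ?e ?g)) (nest m)"
    proof (cases "gamma m = ?g")
      case True
      then have "?e' (gamma m) = ?e ?g - 1" "?e' (gamma m + 1) = ?e (?g + 1)"
        using e'[of ?g] e'[of "?g + 1"] g gL by auto
      \<comment> \<open>Restricted growth, as \<open>tight\<close>, makes the subtraction genuine: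
        lowering the entry by 1 leaves one more child, which is the one to be moved.\<close>
      then show ?thesis using sh True gL gm(3) tight Lm by (simp add: h_def q_def Suc_diff_le)
    next
      case False
      then have lt: "?g < gamma m" using ge by simp
      then have "?e' ?g = 0" using gm(4) g(1) by simp
      then have eg: "?e ?g = 1" using e'[of ?g] g by simp
      \<comment> \<open>The children of node \<open>gamma n\<close> are its path child and those
        gained by castling at the next position; their number must be one more than this
        entry.\<close>
      have next_entry: "?e (?g + 1) = (if gamma m = ?g + 1 then ?e' (gamma m) else 0)"
        using e'[of "?g + 1"] gm(4)[of "?g + 1"] lt gL by auto
      have "?g - 1 < h" using lt g(1) by (simp add: h_def)
      from shape_lower[OF sh this] show ?thesis
        using lt g(1) eg next_entry by (auto simp: h_def split: if_splits)
    qed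
    then show ?thesis using len False G by (simp add: m_def)
  qed
qed

section \<open>Comparison of the two clones\<close>

lemma entry_clone:
  assumes "1 \<le> j" "j < length H div 2"
  shows "entry (clone H) j = sigma j H"
proof -
  define K where "K = length H div 2"
  have "entry (clone H) j = sigma (rev [1..<K] ! (K - 1 - j)) H"
    using assms by (simp add: clone_def entry_def K_def)
  also have "rev [1..<K] ! (K - 1 - j) = j" using assms by (simp add: rev_nth K_def)
  finally show ?thesis .
qed

theorem theorem39:
  fixes n k :: nat and G :: "nat list"
  assumes "n \<ge> 1"
    and "k = trgs_len n + 1"
    and "G = blow_to k (nest (parent n))"
  shows "dyck_nest k G \<and> dyck_nest k (nest n) \<and>
         (\<forall>j \<in> {1..k - 1} - {gamma n}. entry (clone G) j = entry (clone (nest n)) j) \<and>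
         entry (clone G) (gamma n) \<noteq> entry (clone (nest n)) (gamma n)"
proof -
  note g = gamma[OF assms(1)]
  \<comment> \<open>The form \<open>Suc q\<close> guarantees that node \<open>gamma n\<close> has a
    child to give away.\<close>
  obtain p q where len: "length G = 2 * k" and G: "shape (gamma n - 1) p (Suc q) G"
    using shape_nest[OF assms(1)] assms(2,3) by metis
  have Sg: "Suc (gamma n - 1) = gamma n" using g(1) by simp
  have n: "nest n = castle (gamma n) G" using assms by (simp add: nest.simps[of n])
  note C = shape_castle[OF G, unfolded Sg, folded n]
  have "entry (clone G) j = sigma j G" "entry (clone (nest n)) j = sigma j (nest n)"
    if "j \<in> {1..k - 1}" for j
    using that len C(2) by (auto intro!: entry_clone)
  moreover have "gamma n \<in> {1..k - 1}" using g assms(2) by simp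
  ultimately show ?thesis
    using shape_dyck_nest[OF G] shape_dyck_nest[OF C(1)] C(2-4) len by auto
qed

end
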